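(* Consider iteration $k+1$ of the Benson-type algorithm with vertex selection described in the context, applied to the vector convex program (P) under the standing assumptions (A1)–(A5) listed there. Let $s$ be a vertex of both $\mathcal{O}^k$ and $\mathcal{O}^{k+1}$, let $p^*$ be a solution of the problem of minimizing $\|p-s\|^2$ subject to $p\in\mathcal{I}^k$, and let $F(x)$ be such that $\mathcal{I}^{k+1}=\operatorname{cl}\operatorname{conv}(\mathcal{I}^k\cup\{F(x)\})$. Then the following are equivalent: (i) $p^*$ is a solution of the problem of minimizing $\|p-s\|^2$ subject to $p\in\mathcal{I}^{k+1}$; (ii) $(p^*-s)^{\mathsf T}(F(x)-p^* )\geqslant 0$.
   Context: **Problem.** Let $C\subseteq\mathbb{R}^q$ be a pointed convex cone; write $x\leqslant_C y$ iff $y-x\in C$, and $\leqslant$ for the component-wise order. The dual cone is $C^+=\{y\in\mathbb{R}^q\mid y^{\mathsf T}x\geqslant 0\ \forall x\in C\}$. Let $X\subseteq\mathbb{R}^n$ be convex and let $F:X\to\mathbb{R}^q$ be $C$-convex, i.e. $F(\lambda x+(1-\lambda)y)\leqslant_C\lambda F(x)+(1-\lambda)F(y)$ for $x,y\in X$, $\lambda\in[0,1]$. Let $g=(g_1,\dots,g_m)^{\mathsf T}$ with each $g_i:\mathbb{R}^n\to\mathbb{R}\cup\{\infty\}$ convex, $\operatorname{dom} g=\bigcap_{i=1}^m\operatorname{dom} g_i$. The vector convex program (P) is: minimize $F(x)$ with respect to $\leqslant_C$ subject to $g(x)\leqslant 0$, with feasible set $S=\{x\in X\mid g(x)\leqslant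 0\}$. **Standing assumptions.** (A1) $F:X\to\mathbb{R}^q$ is continuous. (A2) The $g_i$ are proper, lower semicontinuous, and their domains are relatively open. (A3) $\bigcap_{i=1}^m\operatorname{ri}\{x\in X\mid g_i(x)\leqslant 0\}\neq\emptyset$, where $\operatorname{ri}$ denotes relative interior. (A4) $S$ is bounded. (A5) $C$ has nonempty interior and $C=\{x\in\mathbb{R}^q\mid Z^{\mathsf T}x\geqslant 0\}$ for a matrix $Z\in\mathbb{R}^{q\times\ell}$ with columns $z^1,\dots,z^\ell$. **Scalar subproblems** ($\|\cdot\|$ is the Euclidean norm). For $w\in\mathbb{R}^q$, (P$_1(w)$) is: $\min w^{\mathsf T}F(x)$ s.t. $g(x)\leqslant 0$, $x\in X$. For $v,c\in\mathbb{R}^q$, (P$_2(v,c)$) is: $\min z$ over $(x,z)\in X\times\mathbb{R}$ s.t. $g(x)\leqslant 0$, $Z^{\mathsf T}(F(x)-v-zc)\leqslant 0$. Its Lagrangian dual (D$_2(v,c)$) is: $\max\ \inf_{x\in X\cap\operatorname{dom}g}\{u^{\mathsf T}g(x)+w^{\mathsf T}F(x)\}-w^{\mathsf T}v$ over $(u,w)\in\mathbb{R}^m\times\mathbb{R}^q$ s.t. $u\geqslant 0$, $w^{\mathsf T}c=1$, $w\in C^+$. For polyhedra $\mathcal{O},\mathcal{I}\subseteq\mathbb{R}^q$ and $s\in\mathbb{R}^q$, (QP$(s,\mathcal{I})$) is: $\min\|p-s\|^2$ s.t. $p\in\mathcal{I}$; and (VS$(\mathcal{O},\mathcal{I})$)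 is: $\max\|p^*-s\|$ over pairs $(s,p^* )$ such that $s$ is a vertex of $\mathcal{O}$ and $p^*$ solves (QP$(s,\mathcal{I})$). **Algorithm.** Input: problem (P), accuracy $\varepsilon>0$, maximal number of iterations $K$. 1. For $j=1,\dots,\ell$ compute a solution $x^j$ of (P$_1(z^j)$). Set $\mathcal{X}=\{x^1,\dots,x^\ell\}$, $\mathcal{O}^0=\bigcap_{j=1}^\ell\{y\in\mathbb{R}^q\mid z^{j\mathsf T}y\geqslant z^{j\mathsf T}F(x^j)\}$, $\mathcal{I}^0=\operatorname{conv}\{F(x^j)\mid j=1,\dots,\ell\}+C$, $k=0$, $d=\infty$. 2. Repeat the following until $d\leqslant\varepsilon$ or $k=K$: compute a solution $(s,p)$ of (VS$(\mathcal{O}^k,\mathcal{I}^k)$) and set $d=\|p-s\|$. If $d>\varepsilon$: set $v=s$, $c=p-s$; compute solutions $(x,z)$ of (P$_2(v,c)$) and $(u,w)$ of (D$_2(v,c)$); replace $\mathcal{X}$ by $\mathcal{X}\cup\{x\}$; set $\mathcal{O}^{k+1}=\mathcal{O}^k\cap\{y\in\mathbb{R}^q\mid w^{\mathsf T}y\geqslant w^{\mathsf T}v+z\}$ and $\mathcal{I}^{k+1}=\operatorname{cl}\operatorname{conv}(\mathcal{I}^k\cup\{F(x)\})$; increase $k$ by $1$. 3. Return $\mathcal{X}$, the vertices of $\mathcal{O}^k$ and the vertices of $\mathcal{I}^k$. *)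

theory Defs
  imports "HOL-Analysis.Analysis"
begin

definition cone_le :: "('a::real_vector) set \<Rightarrow> 'a \<Rightarrow> 'a \<Rightarrow> bool" where
  "cone_le C x y \<longleftrightarrow> y - x \<in> C"

definition pointed :: "('a::real_vector) set \<Rightarrow> bool" where
  "pointed C \<longleftrightarrow> C \<inter> uminus ` C \<subseteq> {0}"

definition dual_cone :: "('a::real_inner) set \<Rightarrow> 'a set" where
  "dual_cone C = {y. \<forall>x\<in>C. 0 \<le> y \<bullet> x}"

definition cone_convex_on ::
  "('b::real_vector) set \<Rightarrow> ('a::real_vector) set \<Rightarrow> ('a \<Rightarrow> 'b) \<Rightarrow> bool" where
  "cone_convex_on C X F \<longleftrightarrow>
     (\<forall>x\<in>X. \<forall>y\<in>X. \<forall>t\<in>{0..1}.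
        cone_le C (F (t *\<^sub>R x + (1 - t) *\<^sub>R y)) (t *\<^sub>R F x + (1 - t) *\<^sub>R F y))"

text \<open>
  Functions with values in the reals extended by \<open>\<infinity>\<close> are modelled as \<open>ereal\<close>-valued functions
  that avoid \<open>-\<infinity>\<close>. For those the right-hand side below is never of the form \<open>\<infinity> - \<infinity>\<close>,
  and the convention \<open>0 * \<infinity> = 0\<close> of \<open>ereal\<close> makes the inequality trivial for \<open>t = 0\<close> and \<open>t = 1\<close>.
\<close>

definition convex_ereal :: "(('a::real_vector) \<Rightarrow> ereal) \<Rightarrow> bool" where
  "convex_ereal f \<longleftrightarrow>
     (\<forall>x y. \<forall>t\<in>{0..1}. f (t *\<^sub>R x + (1 - t) *\<^sub>R y) \<le> ereal t * f x + ereal (1 - t) * f y)"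

definition eff_dom :: "('a \<Rightarrow> ereal) \<Rightarrow> 'a set" where
  "eff_dom f = {x. f x < \<infinity>}"

definition proper :: "('a \<Rightarrow> ereal) \<Rightarrow> bool" where
  "proper f \<longleftrightarrow> eff_dom f \<noteq> {} \<and> (\<forall>x. f x \<noteq> -\<infinity>)"

definition lsc :: "(('a::topological_space) \<Rightarrow> ereal) \<Rightarrow> bool" where
  "lsc f \<longleftrightarrow> (\<forall>x. f x \<le> Liminf (nhds x) f)"

definition feasible_set :: "'a set \<Rightarrow> ('m \<Rightarrow> 'a \<Rightarrow> ereal) \<Rightarrow> 'a set" where
  "feasible_set X g = {x\<in>X. \<forall>i. g i x \<le> 0}"

text \<open>
  The dimensions of the decision space, of the objective space, the number of scalar constraints
  and the number of columns of \<open>Z\<close> are the cardinalities of the index types \<open>'n\<close>, \<open>'q\<close>, \<open>'m\<close>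
  and \<open>'l\<close>. Only the values of \<open>F\<close> on \<open>X\<close> are relevant.
\<close>

locale vector_convex_program =
  fixes C :: "(real ^ 'q) set"
    and Z :: "real ^ 'l ^ 'q"
    and X :: "(real ^ 'n) set"
    and F :: "real ^ 'n \<Rightarrow> real ^ 'q"
    and g :: "('m::finite) \<Rightarrow> real ^ 'n \<Rightarrow> ereal"
  assumes C_cone: "convex_cone C"
    and C_pointed: "pointed C"
    and X_convex: "convex X"
    and F_convex: "cone_convex_on C X F"
    and g_convex: "\<And>i. convex_ereal (g i)"
    and F_continuous: "continuous_on X F"
    and g_proper: "\<And>i. proper (g i)"
    and g_lsc: "\<And>i. lsc (g i)"
    and g_dom: "\<And>i. rel_open (eff_dom (g i))"
    and constraint_qualification: "(\<Inter>i. rel_interior {x\<in>X. g i x \<le> 0}) \<noteq> {}"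
    and feasible_bounded: "bounded (feasible_set X g)"
    and C_interior: "interior C \<noteq> {}"
    and C_polyhedral: "C = {x. 0 \<le> transpose Z *v x}"


definition P1_solution ::
  "(real ^ 'n) set \<Rightarrow> (real ^ 'n \<Rightarrow> real ^ 'q) \<Rightarrow> ('m \<Rightarrow> real ^ 'n \<Rightarrow> ereal) \<Rightarrow>
   real ^ 'q \<Rightarrow> real ^ 'n \<Rightarrow> bool" where
  "P1_solution X F g w x \<longleftrightarrow> is_arg_min (\<lambda>x. w \<bullet> F x) (\<lambda>x. x \<in> feasible_set X g) x"

definition P2_solution ::
  "real ^ 'l ^ 'q \<Rightarrow> (real ^ 'n) set \<Rightarrow> (real ^ 'n \<Rightarrow> real ^ 'q) \<Rightarrow> ('m \<Rightarrow> real ^ 'n \<Rightarrow> ereal) \<Rightarrow>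
   real ^ 'q \<Rightarrow> real ^ 'q \<Rightarrow> (real ^ 'n) \<times> real \<Rightarrow> bool" where
  "P2_solution Z X F g v c xz \<longleftrightarrow>
     is_arg_min (\<lambda>(x, z). z)
       (\<lambda>(x, z). x \<in> feasible_set X g \<and> transpose Z *v (F x - v - z *\<^sub>R c) \<le> 0) xz"

text \<open>The infimum ranges over points at which all \<open>g i\<close> are finite; it may be \<open>-\<infinity>\<close>.\<close>

definition D2_objective ::
  "(real ^ 'n) set \<Rightarrow> (real ^ 'n \<Rightarrow> real ^ 'q) \<Rightarrow> ('m::finite \<Rightarrow> real ^ 'n \<Rightarrow> ereal) \<Rightarrow>
   real ^ 'q \<Rightarrow> (real ^ 'm) \<times> (real ^ 'q) \<Rightarrow> ereal" where
  "D2_objective X F g v = (\<lambda>(u, w).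
     (INF x \<in> X \<inter> (\<Inter>i. eff_dom (g i)). (\<Sum>i\<in>UNIV. ereal (u $ i) * g i x) + ereal (w \<bullet> F x))
       - ereal (w \<bullet> v))"

definition D2_solution ::
  "(real ^ 'q) set \<Rightarrow> (real ^ 'n) set \<Rightarrow> (real ^ 'n \<Rightarrow> real ^ 'q) \<Rightarrow>
   ('m::finite \<Rightarrow> real ^ 'n \<Rightarrow> ereal) \<Rightarrow> real ^ 'q \<Rightarrow> real ^ 'q \<Rightarrow>
   (real ^ 'm) \<times> (real ^ 'q) \<Rightarrow> bool" where
  "D2_solution C X F g v c uw \<longleftrightarrow>
     is_arg_max (D2_objective X F g v)
       (\<lambda>(u, w). 0 \<le> u \<and> w \<bullet> c = 1 \<and> w \<in> dual_cone C) uw"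

definition QP_solution ::
  "('a::real_normed_vector) \<Rightarrow> 'a set \<Rightarrow> 'a \<Rightarrow> bool" where
  "QP_solution s Inn p \<longleftrightarrow> is_arg_min (\<lambda>p. (norm (p - s))\<^sup>2) (\<lambda>p. p \<in> Inn) p"

definition VS_solution ::
  "('a::real_normed_vector) set \<Rightarrow> 'a set \<Rightarrow> 'a \<times> 'a \<Rightarrow> bool" where
  "VS_solution Out Inn sp \<longleftrightarrow>
     is_arg_max (\<lambda>(s, p). norm (p - s))
       (\<lambda>(s, p). s extreme_point_of Out \<and> QP_solution s Inn p) sp"


text \<open>
  A state \<open>(k, d, S, Out, Inn)\<close> consists of the iteration counter, the current value of \<open>d\<close>, the set
  of computed solutions, and the current outer and inner approximations. As the subproblems need not
  have unique solutions, the algorithm is a transition relation.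
\<close>

type_synonym ('n, 'q) benson_state =
  "nat \<times> ereal \<times> (real ^ 'n) set \<times> (real ^ 'q) set \<times> (real ^ 'q) set"

inductive benson_init ::
  "(real ^ 'q) set \<Rightarrow> real ^ 'l ^ 'q \<Rightarrow> (real ^ 'n) set \<Rightarrow> (real ^ 'n \<Rightarrow> real ^ 'q) \<Rightarrow>
   ('m::finite \<Rightarrow> real ^ 'n \<Rightarrow> ereal) \<Rightarrow> ('n, 'q) benson_state \<Rightarrow> bool"
  for C Z X F g
where
  "benson_init C Z X F g
     (0, \<infinity>, range xs,
      (\<Inter>j. {y. column j Z \<bullet> y \<ge> column j Z \<bullet> F (xs j)}),
      convex hull (range (\<lambda>j. F (xs j))) + C)"
  if "\<And>j. P1_solution X F g (column j Z) (xs j)"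

text \<open>One pass through the loop body, entered only if the termination test fails.\<close>

inductive benson_iteration ::
  "(real ^ 'q) set \<Rightarrow> real ^ 'l ^ 'q \<Rightarrow> (real ^ 'n) set \<Rightarrow> (real ^ 'n \<Rightarrow> real ^ 'q) \<Rightarrow>
   ('m::finite \<Rightarrow> real ^ 'n \<Rightarrow> ereal) \<Rightarrow> real \<Rightarrow> nat \<Rightarrow>
   ('n, 'q) benson_state \<Rightarrow> ('n, 'q) benson_state \<Rightarrow> bool"
  for C Z X F g \<epsilon> K
where
  refine: "benson_iteration C Z X F g \<epsilon> K
     (k, d, S, Out, Inn)
     (Suc k, ereal (norm (p - s)), S \<union> {x},
      Out \<inter> {y. w \<bullet> y \<ge> w \<bullet> v + z},
      closure (convex hull (Inn \<union> {F x})))"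
  if "\<not> (d \<le> ereal \<epsilon> \<or> k = K)"
    and "VS_solution Out Inn (s, p)"
    and "norm (p - s) > \<epsilon>"
    and "v = s" and "c = p - s"
    and "P2_solution Z X F g v c (x, z)"
    and "D2_solution C X F g v c (u, w)"
| accept: "benson_iteration C Z X F g \<epsilon> K
     (k, d, S, Out, Inn)
     (k, ereal (norm (p - s)), S, Out, Inn)"
  if "\<not> (d \<le> ereal \<epsilon> \<or> k = K)"
    and "VS_solution Out Inn (s, p)"
    and "norm (p - s) \<le> \<epsilon>"

inductive benson_reachable ::
  "(real ^ 'q) set \<Rightarrow> real ^ 'l ^ 'q \<Rightarrow> (real ^ 'n) set \<Rightarrow> (real ^ 'n \<Rightarrow> real ^ 'q) \<Rightarrow>
   ('m::finite \<Rightarrow> real ^ 'n \<Rightarrow> ereal) \<Rightarrow> real \<Rightarrow> nat \<Rightarrow> ('n, 'q) benson_state \<Rightarrow> bool"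
  for C Z X F g \<epsilon> K
where
  init: "benson_reachable C Z X F g \<epsilon> K \<sigma>" if "benson_init C Z X F g \<sigma>"
| step: "benson_reachable C Z X F g \<epsilon> K \<sigma>'"
  if "benson_reachable C Z X F g \<epsilon> K \<sigma>" and "benson_iteration C Z X F g \<epsilon> K \<sigma> \<sigma>'"

end

theory Submission
  imports Defs
begin

text \<open>
  A point \<open>p\<close> of a convex set is nearest to \<open>s\<close> iff the set lies in the half-space
  \<open>{y. (p - s) \<bullet> (y - p) \<ge> 0}\<close>. As this half-space is closed and convex, adding one point to the
  set and taking the closed convex hull keeps the inclusion iff the new point lies in it. The inner
  approximations of the algorithm are all convex.
\<close>

lemma QP_solution_iff_dist_le:
  "QP_solution s M p \<longleftrightarrow> p \<in> M \<and> (\<forall>y\<in>M. dist p s \<le> dist y s)"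
  by (auto simp: QP_solution_def is_arg_min_def dist_norm not_less
      simp flip: abs_le_square_iff)

text \<open>This is the variational inequality for projections. If it fails at some
  \<open>y\<close>, moving from \<open>p\<close> towards \<open>y\<close> gets closer to
  \<open>s\<close>; conversely, expanding the square around \<open>p\<close> leaves only nonnegative
  extra terms.\<close>

lemma QP_solution_iff_inner:
  fixes p s :: "'a::euclidean_space"
  assumes "convex M"
  shows "QP_solution s M p \<longleftrightarrow> p \<in> M \<and> (\<forall>y\<in>M. 0 \<le> (p - s) \<bullet> (y - p))"
proof (intro iffI conjI ballI)
  assume sol: "QP_solution s M p"
  then show p: "p \<in> M"
    by (simp add: QP_solution_iff_dist_le)
  fix y assume y: "y \<in> M"
  show "0 \<le> (p - s) \<bullet> (y - p)"
  proof (rule ccontr)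
    assume "\<not> 0 \<le> (p - s) \<bullet> (y - p)"
    then have "0 < (s - p) \<bullet> (y - p)"
      by (simp add: inner_diff_left)
    \<comment> \<open>The bound \<open>u \<le> 1\<close> keeps the closer point on the segment from
      \<open>p\<close> to \<open>y\<close>, hence in \<open>M\<close>.\<close>
    then obtain u where u: "u > 0" "u \<le> 1" "dist (p + u *\<^sub>R (y - p)) s < dist p s"
      using closer_point_lemma by blast
    have "p + u *\<^sub>R (y - p) = (1 - u) *\<^sub>R p + u *\<^sub>R y"
      by (simp add: algebra_simps)
    then have "p + u *\<^sub>R (y - p) \<in> M"
      using assms p y u by (simp add: convexD)
    then show False
      using sol u by (force simp: QP_solution_iff_dist_le)
  qed
next
  assume p: "p \<in> M \<and> (\<forall>y\<in>M. 0 \<le> (p - s) \<bullet> (y - p))"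
  have "dist p s \<le> dist y s" if "y \<in> M" for y
  proof -
    \<comment> \<open>Expansion of the square after splitting \<open>y - s\<close> as
      \<open>(p - s) + (y - p)\<close>.\<close>
    have "(norm (y - s))\<^sup>2 = (norm (p - s))\<^sup>2 + 2 * ((p - s) \<bullet> (y - p)) + (norm (y - p))\<^sup>2"
      by (simp add: power2_norm_eq_inner inner_diff inner_commute)
    then have "(norm (p - s))\<^sup>2 \<le> (norm (y - s))\<^sup>2"
      using p that by simp
    then show ?thesis
      by (simp add: dist_norm flip: abs_le_square_iff)
  qed
  then show "QP_solution s M p"
    using p by (simp add: QP_solution_iff_dist_le)
qed

lemma QP_solution_closure_convex_hull_insert:
  fixes p s :: "'a::euclidean_space"
  assumes "convex M" and "QP_solution s M p"
  shows "QP_solution s (closure (convex hull (M \<union> {y}))) p \<longleftrightarrow> 0 \<le> (p - s) \<bullet> (y - p)"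
proof -
  let ?N = "closure (convex hull (M \<union> {y}))"
  let ?H = "{z. (p - s) \<bullet> z \<ge> (p - s) \<bullet> p}"
  have sub: "M \<union> {y} \<subseteq> ?N"
    by (meson closure_subset hull_subset order_trans)
  have p: "p \<in> M" and MH: "M \<subseteq> ?H"
    using assms by (auto simp: QP_solution_iff_inner inner_diff_right)
  \<comment> \<open>Since \<open>p\<close> already lies in \<open>M\<close>, membership in
    \<open>?N\<close> is automatic and optimality reduces to the inclusion in
    \<open>?H\<close>.\<close>
  have N: "QP_solution s ?N p \<longleftrightarrow> ?N \<subseteq> ?H"
    using p sub by (subst QP_solution_iff_inner)
      (auto simp: convex_closure convex_convex_hull inner_diff_right)
  have "?N \<subseteq> ?H" if "y \<in> ?H"
    using MH that
    by (intro closure_minimal hull_minimal closed_halfspace_ge convex_halfspace_ge) simp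
  moreover have "y \<in> ?H" if "?N \<subseteq> ?H"
    using sub that by blast
  ultimately show ?thesis
    using N by (auto simp: inner_diff_right)
qed

text \<open>Convexity is an invariant: the initial set is a Minkowski sum of convex sets,
  \<open>refine\<close> yields the closure of a convex hull, and \<open>accept\<close> keeps the
  set.\<close>

lemma benson_reachable_convex_inner:
  assumes "convex C" and "benson_reachable C Z X F g \<epsilon> K (k, d, S, Out, Inn)"
  shows "convex Inn"
proof -
  \<comment> \<open>Stated for an arbitrary state \<open>\<sigma>\<close>, with \<open>Inn\<close>
    read off as its last component, so that rule induction applies directly.\<close>
  have "convex (snd (snd (snd (snd \<sigma>))))" if "benson_reachable C Z X F g \<epsilon> K \<sigma>" for \<sigma>
    using that
  proof induction
    case (init \<sigma>)
    then show ?case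
      using assms(1)
      by (auto elim!: benson_init.cases intro!: convex_set_plus convex_convex_hull)
  next
    case (step \<sigma> \<sigma>')
    from step.hyps(2) step.IH show ?case
      by cases (auto intro!: convex_closure convex_convex_hull)
  qed
  from this[OF assms(2)] show ?thesis
    by simp
qed

theorem corollary4p4:
  fixes C :: "(real ^ 'q) set"
    and Z :: "real ^ 'l ^ 'q"
    and X :: "(real ^ 'n) set"
    and F :: "real ^ 'n \<Rightarrow> real ^ 'q"
    and g :: "('m::finite) \<Rightarrow> real ^ 'n \<Rightarrow> ereal"
    and \<epsilon> :: real and K k :: nat
    and d d' :: ereal and S S' :: "(real ^ 'n) set"
    and Out Out' Inn Inn' :: "(real ^ 'q) set"
    and s p :: "real ^ 'q" and x :: "real ^ 'n"
  assumes "vector_convex_program C Z X F g"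
    and "\<epsilon> > 0"
    and "benson_reachable C Z X F g \<epsilon> K (k, d, S, Out, Inn)"
    and "benson_iteration C Z X F g \<epsilon> K (k, d, S, Out, Inn) (Suc k, d', S', Out', Inn')"
    and "s extreme_point_of Out" and "s extreme_point_of Out'"
    and "QP_solution s Inn p"
    and "x \<in> X" and "Inn' = closure (convex hull (Inn \<union> {F x}))"
  shows "QP_solution s Inn' p \<longleftrightarrow> (p - s) \<bullet> (F x - p) \<ge> 0"
proof -
  interpret vector_convex_program C Z X F g
    by fact
  have "convex C"
    using C_cone by (simp add: convex_cone_def)
  then have "convex Inn"
    using assms(3) by (rule benson_reachable_convex_inner)
  then show ?thesis
    using assms(7,9) by (simp only: QP_solution_closure_convex_hull_insert)
qed

end
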